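(* Binary $\mathrm{DynQF}$ profits from padding: for every Boolean graph property $\mathcal Q$ there is a binary $\mathrm{DynQF}$-program that maintains $\mathcal Q$ (under edge insertions and deletions) on every domain $D=D^+\uplus D^-$ whose non-modifiable part $D^-$ is sufficiently large in comparison to the modifiable part $D^+$.
   Context: $\mathrm{DynQF}$: dynamic programs whose auxiliary schema contains relation symbols and function symbols (constants being $0$-ary functions); each auxiliary relation $R$ is updated after a modification $\delta\in\{\mathrm{ins}_E,\mathrm{del}_E\}$ by a quantifier-free formula $\varphi^R_\delta(\vec x;\vec y)$ over the combined input and auxiliary schema (terms may use the function symbols), and each auxiliary function $f$ by an update term $t^f_\delta(\vec x;\vec y)$ built from variables, function symbols and the construct $\mathrm{ITE}(\varphi,t_1,t_2)$ with $\varphi$ quantifier-free (value $t_1$ if $\varphi$ holds, else $t_2$). After a modification $\delta(\vec a)$ the input graph is modified and each auxiliary relation/function is reinterpreted by evaluating its update formula/term with $\vec x:=\vec a$ in the old state. A dynamic program has an arbitrary initialization mapping from the initial input to initial auxiliary data and a designated $0$-ary query symbol $Q$; it maintains $\mathcal Q$ if, for every initial input graph and every sequence of modifications, $Q$ holds after the sequence iff the current graph has property $\mathcal Q$. The program is binary if all auxiliary relations and functions have arity at most $2$. Padding setting: every domain is a disjoint union $D=D^+\uplus D^-$ of a modifiable part $D^+$ and a non-modifiable part $D^-$; input graphs and all modifications (edge insertions and deletions) involve only nodes of $D^+$, while auxiliary data may use all of $D$. A dynamic complexity class profits from padding if every Boolean graph property can be maintained in it whenever the non-modifiable domain is sufficiently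 large in comparison to the modifiable domain. *)

theory Defs
  imports Main "HOL-Library.FuncSet"
begin

text \<open>
  Input graphs are directed graphs (loops allowed), given by a finite vertex set and an edge set.
  A Boolean graph property is, as usual, an isomorphism-closed class of finite graphs.
\<close>

definition graph_property :: "('a set \<Rightarrow> ('a \<times> 'a) set \<Rightarrow> bool) \<Rightarrow> bool" where
  "graph_property \<Q> \<longleftrightarrow>
     (\<forall>V E h. finite V \<and> E \<subseteq> V \<times> V \<and> inj_on h V \<longrightarrow>
        (\<Q> (h ` V) (map_prod h h ` E) \<longleftrightarrow> \<Q> V E))"

datatype mod_kind = Ins | Del

type_synonym 'a modification = "mod_kind \<times> 'a \<times> 'a"

fun modify :: "'a modification \<Rightarrow> ('a \<times> 'a) set \<Rightarrow> ('a \<times> 'a) set" where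
  "modify (Ins, a, b) E = insert (a, b) E"
| "modify (Del, a, b) E = E - {(a, b)}"

text \<open>
  \<open>VarX i\<close> is the variable for the i-th component of the modified tuple, \<open>VarY j\<close> the variable for
  the j-th argument of the updated auxiliary symbol (both counted from 0).
  Auxiliary relation and function symbols are natural numbers, used as indices into the arity
  lists of the program.
\<close>

datatype tm = VarX nat | VarY nat | Fn nat "tm list"

datatype rel_sym = Edge | Aux nat

datatype qf =
    Atom rel_sym "tm list"
  | Eq tm tm
  | Neg qf
  | And qf qf
  | Or qf qf

datatype uterm =
    UVarX nat
  | UVarY nat
  | UFn nat "uterm list"
  | ITE qf uterm uterm

record 'a aux_data =
  aux_rel :: "nat \<Rightarrow> 'a list set"
  aux_fun :: "nat \<Rightarrow> 'a list \<Rightarrow> 'a"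

text \<open>A state consists of the current edge relation and the current auxiliary data.\<close>

type_synonym 'a state = "('a \<times> 'a) set \<times> 'a aux_data"

primrec eval_tm :: "'a state \<Rightarrow> 'a list \<Rightarrow> 'a list \<Rightarrow> tm \<Rightarrow> 'a" where
  "eval_tm S xs ys (VarX i) = xs ! i"
| "eval_tm S xs ys (VarY i) = ys ! i"
| "eval_tm S xs ys (Fn f ts) = aux_fun (snd S) f (map (eval_tm S xs ys) ts)"

fun holds_rel :: "'a state \<Rightarrow> rel_sym \<Rightarrow> 'a list \<Rightarrow> bool" where
  "holds_rel S Edge as \<longleftrightarrow> (\<exists>u v. as = [u, v] \<and> (u, v) \<in> fst S)"
| "holds_rel S (Aux R) as \<longleftrightarrow> as \<in> aux_rel (snd S) R"

primrec eval_qf :: "'a state \<Rightarrow> 'a list \<Rightarrow> 'a list \<Rightarrow> qf \<Rightarrow> bool" where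
  "eval_qf S xs ys (Atom R ts) \<longleftrightarrow> holds_rel S R (map (eval_tm S xs ys) ts)"
| "eval_qf S xs ys (Eq s t) \<longleftrightarrow> eval_tm S xs ys s = eval_tm S xs ys t"
| "eval_qf S xs ys (Neg p) \<longleftrightarrow> \<not> eval_qf S xs ys p"
| "eval_qf S xs ys (And p q) \<longleftrightarrow> eval_qf S xs ys p \<and> eval_qf S xs ys q"
| "eval_qf S xs ys (Or p q) \<longleftrightarrow> eval_qf S xs ys p \<or> eval_qf S xs ys q"

primrec eval_uterm :: "'a state \<Rightarrow> 'a list \<Rightarrow> 'a list \<Rightarrow> uterm \<Rightarrow> 'a" where
  "eval_uterm S xs ys (UVarX i) = xs ! i"
| "eval_uterm S xs ys (UVarY i) = ys ! i"
| "eval_uterm S xs ys (UFn f ts) = aux_fun (snd S) f (map (eval_uterm S xs ys) ts)"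
| "eval_uterm S xs ys (ITE p s t) =
     (if eval_qf S xs ys p then eval_uterm S xs ys s else eval_uterm S xs ys t)"

text \<open>
  The auxiliary schema is given by the lists of arities of its relation and function symbols, so
  it is finite. The initialization mapping receives the modifiable part of the domain, the
  non-modifiable part and the initial edge relation.
\<close>

record 'a program =
  rel_arity :: "nat list"
  fun_arity :: "nat list"
  rel_update :: "mod_kind \<Rightarrow> nat \<Rightarrow> qf"
  fun_update :: "mod_kind \<Rightarrow> nat \<Rightarrow> uterm"
  init :: "'a set \<Rightarrow> 'a set \<Rightarrow> ('a \<times> 'a) set \<Rightarrow> 'a aux_data"
  query :: nat

text \<open>
  Well-formedness of terms and formulas over the schema of a program, for an auxiliary symbol of
  arity \<open>k\<close>; the modified tuple always has two components.
\<close>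

primrec wf_tm :: "('a, 'b) program_scheme \<Rightarrow> nat \<Rightarrow> tm \<Rightarrow> bool" where
  "wf_tm P k (VarX i) \<longleftrightarrow> i < 2"
| "wf_tm P k (VarY i) \<longleftrightarrow> i < k"
| "wf_tm P k (Fn f ts) \<longleftrightarrow>
     f < length (fun_arity P) \<and> length ts = fun_arity P ! f \<and> list_all (wf_tm P k) ts"

fun wf_rel_sym :: "('a, 'b) program_scheme \<Rightarrow> rel_sym \<Rightarrow> nat \<Rightarrow> bool" where
  "wf_rel_sym P Edge n \<longleftrightarrow> n = 2"
| "wf_rel_sym P (Aux R) n \<longleftrightarrow> R < length (rel_arity P) \<and> n = rel_arity P ! R"

primrec wf_qf :: "('a, 'b) program_scheme \<Rightarrow> nat \<Rightarrow> qf \<Rightarrow> bool" where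
  "wf_qf P k (Atom R ts) \<longleftrightarrow> wf_rel_sym P R (length ts) \<and> list_all (wf_tm P k) ts"
| "wf_qf P k (Eq s t) \<longleftrightarrow> wf_tm P k s \<and> wf_tm P k t"
| "wf_qf P k (Neg p) \<longleftrightarrow> wf_qf P k p"
| "wf_qf P k (And p q) \<longleftrightarrow> wf_qf P k p \<and> wf_qf P k q"
| "wf_qf P k (Or p q) \<longleftrightarrow> wf_qf P k p \<and> wf_qf P k q"

primrec wf_uterm :: "('a, 'b) program_scheme \<Rightarrow> nat \<Rightarrow> uterm \<Rightarrow> bool" where
  "wf_uterm P k (UVarX i) \<longleftrightarrow> i < 2"
| "wf_uterm P k (UVarY i) \<longleftrightarrow> i < k"
| "wf_uterm P k (UFn f ts) \<longleftrightarrow>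
     f < length (fun_arity P) \<and> length ts = fun_arity P ! f \<and> list_all (wf_uterm P k) ts"
| "wf_uterm P k (ITE p s t) \<longleftrightarrow> wf_qf P k p \<and> wf_uterm P k s \<and> wf_uterm P k t"

definition tuples :: "'a set \<Rightarrow> nat \<Rightarrow> 'a list set" where
  "tuples D k = {as. length as = k \<and> set as \<subseteq> D}"

text \<open>
  Auxiliary data over a domain \<open>D\<close>. Values of functions outside \<open>D\<close>-tuples of the right length
  are irrelevant: well-formed update terms never access them.
\<close>

definition aux_data_over :: "('a, 'b) program_scheme \<Rightarrow> 'a set \<Rightarrow> 'a aux_data \<Rightarrow> bool" where
  "aux_data_over P D A \<longleftrightarrow>
     (\<forall>R < length (rel_arity P). aux_rel A R \<subseteq> tuples D (rel_arity P ! R)) \<and>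
     (\<forall>f < length (fun_arity P). aux_fun A f \<in> tuples D (fun_arity P ! f) \<rightarrow> D)"

definition padded_domain :: "'a set \<Rightarrow> 'a set \<Rightarrow> bool" where
  "padded_domain Dp Dm \<longleftrightarrow> finite Dp \<and> finite Dm \<and> Dp \<inter> Dm = {} \<and> Dp \<union> Dm \<noteq> {}"

definition DynQF :: "'a program set" where
  "DynQF = {P.
     (\<forall>\<delta>. \<forall>R < length (rel_arity P). wf_qf P (rel_arity P ! R) (rel_update P \<delta> R)) \<and>
     (\<forall>\<delta>. \<forall>f < length (fun_arity P). wf_uterm P (fun_arity P ! f) (fun_update P \<delta> f)) \<and>
     (\<forall>Dp Dm E. padded_domain Dp Dm \<and> E \<subseteq> Dp \<times> Dp \<longrightarrow>
        aux_data_over P (Dp \<union> Dm) (init P Dp Dm E)) \<and>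
     query P < length (rel_arity P) \<and> rel_arity P ! query P = 0}"

definition binary_DynQF :: "'a program set" where
  "binary_DynQF =
     {P \<in> DynQF. (\<forall>k \<in> set (rel_arity P). k \<le> 2) \<and> (\<forall>k \<in> set (fun_arity P). k \<le> 2)}"

text \<open>
  One update step on the domain \<open>D\<close>: all update formulas and terms are evaluated in the old state,
  including the old edge relation.
\<close>

fun step :: "'a program \<Rightarrow> 'a set \<Rightarrow> 'a modification \<Rightarrow> 'a state \<Rightarrow> 'a state" where
  "step P D (\<delta>, a, b) S =
     (modify (\<delta>, a, b) (fst S),
      \<lparr>aux_rel = (\<lambda>R. {ys \<in> tuples D (rel_arity P ! R). eval_qf S [a, b] ys (rel_update P \<delta> R)}),
       aux_fun = (\<lambda>f ys. eval_uterm S [a, b] ys (fun_update P \<delta> f))\<rparr>)"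

definition run :: "'a program \<Rightarrow> 'a set \<Rightarrow> 'a modification list \<Rightarrow> 'a state \<Rightarrow> 'a state" where
  "run P D \<alpha> S = fold (step P D) \<alpha> S"

definition maintains_on ::
  "'a program \<Rightarrow> ('a set \<Rightarrow> ('a \<times> 'a) set \<Rightarrow> bool) \<Rightarrow> 'a set \<Rightarrow> 'a set \<Rightarrow> bool" where
  "maintains_on P \<Q> Dp Dm \<longleftrightarrow>
     (\<forall>E \<alpha>. E \<subseteq> Dp \<times> Dp \<and> set \<alpha> \<subseteq> UNIV \<times> Dp \<times> Dp \<longrightarrow>
        ([] \<in> aux_rel (snd (run P (Dp \<union> Dm) \<alpha> (E, init P Dp Dm E))) (query P)
           \<longleftrightarrow> \<Q> Dp (fold modify \<alpha> E)))"

text \<open>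
  The current graph is the graph on the modifiable part \<open>Dp\<close>. A single program and a single bound
  \<open>b\<close> on the size of the padding work for all domains. Domains are finite subsets of
  the type \<open>'a\<close>; every infinite type contains domains of all finite sizes.
\<close>

definition profits_from_padding :: "'a program set \<Rightarrow> bool" where
  "profits_from_padding \<C> \<longleftrightarrow>
     (\<forall>\<Q>. graph_property \<Q> \<longrightarrow>
        (\<exists>P \<in> \<C>. \<exists>b :: nat \<Rightarrow> nat. \<forall>Dp Dm.
           padded_domain Dp Dm \<and> b (card Dp) \<le> card Dm \<longrightarrow> maintains_on P \<Q> Dp Dm))"

end

theory Submission
  imports Defs
begin

text \<open>
  Every graph on the modifiable part, and every pair of such a graph and a modifiable node, gets
  its own padding element as code. A constant stores the code of the current graph. A modification
  is a function of three arguments, the current graph and the two modified nodes; it is split into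
  two lookups in static binary tables, the first of which returns the code of the current graph
  together with the first node. A static unary relation lists the codes of the graphs having the
  property.
\<close>

text \<open>\<open>(F, None)\<close> is the graph \<open>F\<close> itself;
  \<open>(F, Some a)\<close> is the result of the first lookup of a modification whose first node is
  \<open>a\<close>.\<close>

definition graph_configs :: "'a set \<Rightarrow> (('a \<times> 'a) set \<times> 'a option) set" where
  "graph_configs V = Pow (V \<times> V) \<times> insert None (Some ` V)"

definition graph_code :: "'a set \<Rightarrow> 'a set \<Rightarrow> ('a \<times> 'a) set \<times> 'a option \<Rightarrow> 'a" where
  "graph_code V W = (SOME e. inj_on e (graph_configs V) \<and> e ` graph_configs V \<subseteq> W)"

definition graph_decode :: "'a set \<Rightarrow> 'a set \<Rightarrow> 'a \<Rightarrow> ('a \<times> 'a) set \<times> 'a option" where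
  "graph_decode V W = inv_into (graph_configs V) (graph_code V W)"

text \<open>Keeps table values in the domain when the padding is too small for a coding.\<close>

definition clamp :: "'a set \<Rightarrow> 'a \<Rightarrow> 'a" where
  "clamp D x = (if x \<in> D then x else (SOME y. y \<in> D))"

lemma clamp_in: "D \<noteq> {} \<Longrightarrow> clamp D x \<in> D"
  by (auto simp: clamp_def some_in_eq)

lemma clamp_id: "x \<in> D \<Longrightarrow> clamp D x = x"
  by (simp add: clamp_def)

lemma card_graph_configs:
  assumes "finite V"
  shows "card (graph_configs V) = 2 ^ (card V * card V) * Suc (card V)"
  using assms
  by (simp add: graph_configs_def card_cartesian_product card_Pow card_insert_if card_image)

text \<open>Counting yields an injection into the padding, so the choice in
  \<open>graph_code\<close> meets its specification.\<close>

lemma graph_code: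
  assumes "finite V" "finite W" "2 ^ (card V * card V) * Suc (card V) \<le> card W"
  shows "inj_on (graph_code V W) (graph_configs V)"
    and "graph_code V W ` graph_configs V \<subseteq> W"
proof -
  have "finite (graph_configs V)"
    using assms(1) by (simp add: graph_configs_def)
  then have "\<exists>e. inj_on e (graph_configs V) \<and> e ` graph_configs V \<subseteq> W"
    using card_le_inj[of "graph_configs V" W] assms by (auto simp: card_graph_configs)
  from someI_ex[OF this]
  show "inj_on (graph_code V W) (graph_configs V)" "graph_code V W ` graph_configs V \<subseteq> W"
    by (auto simp: graph_code_def)
qed

text \<open>The kind of modification enters through the choice of the second table, not through the
  code.\<close>

fun apply_sym :: "mod_kind \<Rightarrow> nat" where
  "apply_sym Ins = 2"
| "apply_sym Del = 3"

definition init_rel ::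
  "('a set \<Rightarrow> ('a \<times> 'a) set \<Rightarrow> bool) \<Rightarrow> 'a set \<Rightarrow> 'a set \<Rightarrow> ('a \<times> 'a) set \<Rightarrow> nat \<Rightarrow> 'a list set" where
  "init_rel \<Q> V W E R =
     (if R = 0 then {ys. ys = [] \<and> \<Q> V E}
      else {[x] |x. x \<in> V \<union> W \<and> \<Q> V (fst (graph_decode V W x))})"

text \<open>Symbol 0 holds the current code, 1 is the first lookup, 2 and 3 are the second. Values
  off the intended codes are arbitrary elements of the domain.\<close>

definition init_fun :: "'a set \<Rightarrow> 'a set \<Rightarrow> ('a \<times> 'a) set \<Rightarrow> nat \<Rightarrow> 'a list \<Rightarrow> 'a" where
  "init_fun V W E f ys = clamp (V \<union> W) (graph_code V W
     (if f = 0 then (E, None)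
      else let (F, a) = graph_decode V W (ys ! 0) in
        if f = 1 then (F, Some (ys ! 1))
        else (modify (if f = 2 then Ins else Del, the a, ys ! 1) F, None)))"

text \<open>Updates are evaluated in the old state, so the query cannot read the new value of symbol
  0 and repeats the nested term that computes it. All other symbols copy themselves.\<close>

definition padding_program :: "('a set \<Rightarrow> ('a \<times> 'a) set \<Rightarrow> bool) \<Rightarrow> 'a program" where
  "padding_program \<Q> =
     \<lparr>rel_arity = [0, 1],
      fun_arity = [0, 2, 2, 2],
      rel_update = (\<lambda>\<delta> R. Atom (Aux 1)
        [if R = 0 then Fn (apply_sym \<delta>) [Fn 1 [Fn 0 [], VarX 0], VarX 1] else VarY 0]),
      fun_update = (\<lambda>\<delta> f.
        if f = 0 then UFn (apply_sym \<delta>) [UFn 1 [UFn 0 [], UVarX 0], UVarX 1]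
        else UFn f [UVarY 0, UVarY 1]),
      init = (\<lambda>V W E. \<lparr>aux_rel = init_rel \<Q> V W E, aux_fun = init_fun V W E\<rparr>),
      query = 0\<rparr>"

text \<open>Initial data must lie in every padded domain, even one too small for an injective code;
  \<open>clamp\<close> ensures this for the tables.\<close>

lemma padding_program_binary: "padding_program \<Q> \<in> binary_DynQF"
proof -
  have "apply_sym \<delta> < 4" "[0, 2, 2, 2] ! apply_sym \<delta> = (2::nat)" for \<delta>
    by (cases \<delta>; simp)+
  moreover have "init_fun V W E f ys \<in> V \<union> W" if "V \<union> W \<noteq> {}" for V W :: "'a set" and E f ys
    using clamp_in[OF that] by (simp add: init_fun_def)
  moreover have "init_rel \<Q> V W E R \<subseteq> tuples (V \<union> W) ([0, 1] ! R)" if "R < 2" for V W E R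
    using that by (auto simp: init_rel_def tuples_def less_2_cases_iff)
  ultimately show ?thesis
    by (auto simp: binary_DynQF_def DynQF_def padding_program_def aux_data_over_def
        padded_domain_def less_Suc_eq numeral_eq_Suc)
qed

text \<open>The invariant of a run. The table clauses range over all graphs \<open>F\<close> and do
  not mention the current one, so copying the tables preserves them.\<close>

definition table_state ::
  "('a set \<Rightarrow> ('a \<times> 'a) set \<Rightarrow> bool) \<Rightarrow> 'a set \<Rightarrow> 'a set \<Rightarrow> 'a state \<Rightarrow> bool" where
  "table_state \<Q> V W S \<longleftrightarrow>
     fst S \<subseteq> V \<times> V \<and>
     ([] \<in> aux_rel (snd S) 0 \<longleftrightarrow> \<Q> V (fst S)) \<and>
     (\<forall>F \<subseteq> V \<times> V. [graph_code V W (F, None)] \<in> aux_rel (snd S) 1 \<longleftrightarrow> \<Q> V F) \<and>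
     aux_fun (snd S) 0 [] = graph_code V W (fst S, None) \<and>
     (\<forall>F \<subseteq> V \<times> V. \<forall>a \<in> V.
        aux_fun (snd S) 1 [graph_code V W (F, None), a] = graph_code V W (F, Some a)) \<and>
     (\<forall>\<delta>. \<forall>F \<subseteq> V \<times> V. \<forall>a \<in> V. \<forall>b \<in> V.
        aux_fun (snd S) (apply_sym \<delta>) [graph_code V W (F, Some a), b]
          = graph_code V W (modify (\<delta>, a, b) F, None))"

lemma modify_subset: "F \<subseteq> V \<times> V \<Longrightarrow> a \<in> V \<Longrightarrow> b \<in> V \<Longrightarrow> modify (\<delta>, a, b) F \<subseteq> V \<times> V"
  by (cases \<delta>) auto

context
  fixes V W :: "'a set"
  assumes fin: "finite V" "finite W"
    and large: "2 ^ (card V * card V) * Suc (card V) \<le> card W"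
begin

lemma decode_code: "c \<in> graph_configs V \<Longrightarrow> graph_decode V W (graph_code V W c) = c"
  using graph_code(1)[OF fin large] by (simp add: graph_decode_def)

lemma code_in: "c \<in> graph_configs V \<Longrightarrow> graph_code V W c \<in> V \<union> W"
  using graph_code(2)[OF fin large] by blast

lemma clamp_code: "c \<in> graph_configs V \<Longrightarrow> clamp (V \<union> W) (graph_code V W c) = graph_code V W c"
  by (rule clamp_id[OF code_in])

lemma None_config: "F \<subseteq> V \<times> V \<Longrightarrow> (F, None) \<in> graph_configs V"
  by (simp add: graph_configs_def)

lemma Some_config: "F \<subseteq> V \<times> V \<Longrightarrow> a \<in> V \<Longrightarrow> (F, Some a) \<in> graph_configs V"
  by (simp add: graph_configs_def)

lemmas code_simps = decode_code clamp_code None_config Some_config modify_subset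

lemma table_state_init:
  assumes "E \<subseteq> V \<times> V"
  shows "table_state \<Q> V W (E, init (padding_program \<Q>) V W E)"
proof -
  \<comment> \<open>The modified graph is again a graph on \<open>V\<close>, so it has a code and
    \<open>clamp\<close> leaves that code unchanged.\<close>
  have "init_fun V W E (apply_sym \<delta>) [graph_code V W (F, Some a), b]
      = graph_code V W (modify (\<delta>, a, b) F, None)"
    if "F \<subseteq> V \<times> V" "a \<in> V" "b \<in> V" for \<delta> F a b
    using modify_subset[OF that, of \<delta>] that
    by (cases \<delta>) (simp_all add: init_fun_def code_simps del: modify.simps)
  moreover have "init_fun V W E 1 [graph_code V W (F, None), a] = graph_code V W (F, Some a)"
    if "F \<subseteq> V \<times> V" "a \<in> V" for F a
    using that by (simp add: init_fun_def code_simps)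
  moreover have "[graph_code V W (F, None)] \<in> init_rel \<Q> V W E 1 \<longleftrightarrow> \<Q> V F"
    if "F \<subseteq> V \<times> V" for F
    using that code_in[OF None_config] by (simp add: init_rel_def code_simps)
  ultimately show ?thesis
    using assms
    by (simp add: table_state_def padding_program_def init_rel_def init_fun_def code_simps
        del: modify.simps)
qed

lemma table_state_step:
  assumes S: "table_state \<Q> V W S" and ab: "a \<in> V" "b \<in> V"
  shows "table_state \<Q> V W (step (padding_program \<Q>) (V \<union> W) (\<delta>, a, b) S)"
proof -
  \<comment> \<open>Only function symbol 0 is recomputed, hence the tables of the second lookup are
    copied.\<close>
  have sym: "apply_sym \<delta>' \<noteq> 0" for \<delta>' by (cases \<delta>') auto
  have E: "fst S \<subseteq> V \<times> V" using S by (simp add: table_state_def)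
  note E' = modify_subset[OF E ab, of \<delta>]
  have new: "aux_fun (snd S) (apply_sym \<delta>) [aux_fun (snd S) 1 [aux_fun (snd S) 0 [], a], b]
      = graph_code V W (modify (\<delta>, a, b) (fst S), None)"
    using S ab E by (simp add: table_state_def del: modify.simps)
  \<comment> \<open>A step restricts relation 1 to tuples over \<open>V \<union> W\<close>; graph
    codes stay in it because \<open>code_in\<close> places them in the domain.\<close>
  show ?thesis
    using S E' new code_in[OF None_config]
    by (simp add: table_state_def padding_program_def tuples_def sym del: modify.simps)
qed

lemma table_state_fold:
  assumes "table_state \<Q> V W S" "set \<alpha> \<subseteq> UNIV \<times> V \<times> V"
  shows "table_state \<Q> V W (fold (step (padding_program \<Q>) (V \<union> W)) \<alpha> S)"
  using assms
proof (induction \<alpha> arbitrary: S)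
  case (Cons m \<alpha>)
  then obtain \<delta> a b where "m = (\<delta>, a, b)" "a \<in> V" "b \<in> V" by (cases m) auto
  with Cons table_state_step show ?case by (simp del: step.simps)
qed simp

end

text \<open>Identifies the graph in the invariant with the one that \<open>maintains_on\<close> asks
  about.\<close>

lemma fst_fold_step: "fst (fold (step P D) \<alpha> S) = fold modify \<alpha> (fst S)"
proof (induction \<alpha> arbitrary: S)
  case (Cons m \<alpha>)
  then show ?case by (cases m) simp
qed simp

theorem theorem6p5:
  shows "profits_from_padding (binary_DynQF :: 'a program set)"
proof -
  have "maintains_on (padding_program \<Q>) \<Q> V W"
    if "padded_domain V W" "2 ^ (card V * card V) * Suc (card V) \<le> card W"
    for \<Q> and V W :: "'a set"
  proof -
    have fin: "finite V" "finite W" using that(1) by (auto simp: padded_domain_def)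
    have "query (padding_program \<Q>) = 0" by (simp add: padding_program_def)
    moreover have "table_state \<Q> V W
        (run (padding_program \<Q>) (V \<union> W) \<alpha> (E, init (padding_program \<Q>) V W E))"
      if "E \<subseteq> V \<times> V" "set \<alpha> \<subseteq> UNIV \<times> V \<times> V" for E \<alpha>
      unfolding run_def
      using table_state_fold[OF fin \<open>_ \<le> card W\<close> table_state_init[OF fin \<open>_ \<le> card W\<close> that(1)]
          that(2)] .
    ultimately show ?thesis
      by (simp add: maintains_on_def table_state_def run_def fst_fold_step)
  qed
  then show ?thesis
    unfolding profits_from_padding_def
    \<comment> \<open>The bound counts configurations on \<open>n\<close> nodes:
      \<open>2 ^ (n * n)\<close> graphs, loops included, each alone or paired with one of the
      \<open>n\<close> nodes.\<close>
    by (intro allI impI bexI[OF _ padding_program_binary] exI[of _ "\<lambda>n. 2 ^ (n * n) * Suc n"]) auto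
qed

end
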